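(* Let $n,d\in\mathbb N=\{1,2,\dots\}$ and let $f\in H_{n,2d}$ with $f\notin(\Sigma+C)_{n,2d}$. Then for all $m,\ell\in\mathbb N$: (i) $f\notin(\Sigma+C)_{n+m,2d}$, where $f$ is regarded as a form in the variables $x_1,\dots,x_{n+m}$; (ii) $x_1^{2\ell}f\notin(\Sigma+C)_{n,2d+2\ell}$.
   Context: $H_{n,k}$ is the real vector space of forms of degree $k$ in $x_1,\dots,x_n$. $\Sigma_{n,2d}\subseteq H_{n,2d}$ is the set of finite sums of squares of forms in $H_{n,d}$. For $f=\sum_\alpha f_\alpha x^\alpha\in H_{n,2d}$: $\operatorname{supp}(f)=\{\alpha\in\mathbb N_0^n:f_\alpha\neq0\}$, $\operatorname{New}(f)=\operatorname{conv}(\operatorname{supp}(f))$, $V(f)$ is the vertex set of $\operatorname{New}(f)$, $\mathcal S(f)=\{\alpha\in\operatorname{supp}(f):\alpha\in(2\mathbb N_0)^n,\ f_\alpha>0\}$, $\mathcal I(f)=\operatorname{supp}(f)\setminus\mathcal S(f)$. A form $f\in H_{n,2d}$ is a circuit if $\mathcal S(f)=V(f)$, $V(f)$ is affinely independent (single points and the empty set count as affinely independent), and either $\mathcal I(f)=\emptyset$ or $\mathcal I(f)=\{\beta\}$ with $\beta$ in the relative interior of $\operatorname{New}(f)$. It is a nonnegative circuit if moreover $f\ge0$ on $\mathbb R^n$. $C_{n,2d}$ is the set of all finite sums of nonnegative circuits in $H_{n,2d}$. $(\Sigma+C)_{n,2d}=\{g+h: g\in\Sigma_{n,2d},\ h\in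 C_{n,2d}\}$. *)

theory Defs
  imports "HOL-Analysis.Analysis" "HOL-Analysis.Finite_Function_Topology"
begin

(* A monomial x^alpha is given by its finitely supported exponent vector alpha, and a polynomial
   by its finitely supported coefficient function; multiplication is the convolution product.
   All polynomials live in the variables x_0, x_1, x_2, ...; the
   variables x_1, ..., x_n of the usual notation are those with indices 0, ..., n - 1. Thus a
   polynomial in n variables is literally also a polynomial in n + m variables. *)
type_synonym monom_exp = "nat \<Rightarrow>\<^sub>0 nat"
type_synonym real_mpoly = "(nat \<Rightarrow>\<^sub>0 nat) \<Rightarrow>\<^sub>0 real"

definition var :: "nat \<Rightarrow> real_mpoly" where
  "var i = Poly_Mapping.single (Poly_Mapping.single i 1) 1"

definition eval_mpoly :: "real_mpoly \<Rightarrow> (nat \<Rightarrow> real) \<Rightarrow> real" where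
  "eval_mpoly f x =
     (\<Sum>\<alpha>\<in>Poly_Mapping.keys f. Poly_Mapping.lookup f \<alpha> *
        (\<Prod>i\<in>Poly_Mapping.keys \<alpha>. x i ^ Poly_Mapping.lookup \<alpha> i))"

definition exp_degree :: "monom_exp \<Rightarrow> nat" where
  "exp_degree \<alpha> = (\<Sum>i\<in>Poly_Mapping.keys \<alpha>. Poly_Mapping.lookup \<alpha> i)"

(* H_{n,k}; in particular 0 is a form of every degree. *)
definition forms :: "nat \<Rightarrow> nat \<Rightarrow> real_mpoly set" where
  "forms n k =
     {f. \<forall>\<alpha>\<in>Poly_Mapping.keys f. Poly_Mapping.keys \<alpha> \<subseteq> {..<n} \<and> exp_degree \<alpha> = k}"

(* The embedding of N_0^n into R^n, with R^n seen as the vectors of nat =>_0 real supported on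
   {..<n}. The norm of nat =>_0 real is the l^1 norm, so it induces the usual topology on each R^n,
   and convex hulls, vertices, affine independence and relative interiors do not depend on n. *)
definition real_exp :: "monom_exp \<Rightarrow> (nat \<Rightarrow>\<^sub>0 real)" where
  "real_exp \<alpha> = Poly_Mapping.map real \<alpha>"

abbreviation supp :: "real_mpoly \<Rightarrow> monom_exp set" where
  "supp f \<equiv> Poly_Mapping.keys f"

definition New :: "real_mpoly \<Rightarrow> (nat \<Rightarrow>\<^sub>0 real) set" where
  "New f = convex hull (real_exp ` supp f)"

definition New_vertices :: "real_mpoly \<Rightarrow> (nat \<Rightarrow>\<^sub>0 real) set" where
  "New_vertices f = {v. v extreme_point_of New f}"

(* S(f) *)
definition even_pos_supp :: "real_mpoly \<Rightarrow> monom_exp set" where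
  "even_pos_supp f =
     {\<alpha> \<in> supp f. (\<forall>i. even (Poly_Mapping.lookup \<alpha> i)) \<and> Poly_Mapping.lookup f \<alpha> > 0}"

(* I(f) *)
definition rest_supp :: "real_mpoly \<Rightarrow> monom_exp set" where
  "rest_supp f = supp f - even_pos_supp f"

(* The library's affine_dependent makes the empty set and singletons affinely independent. *)
definition is_circuit :: "real_mpoly \<Rightarrow> bool" where
  "is_circuit f \<longleftrightarrow>
     real_exp ` even_pos_supp f = New_vertices f \<and>
     \<not> affine_dependent (New_vertices f) \<and>
     (rest_supp f = {} \<or>
      (\<exists>\<beta>. rest_supp f = {\<beta>} \<and> real_exp \<beta> \<in> rel_interior (New f)))"

(* The second argument of the following sets is half the degree: they are the nonnegative circuits
   in H_{n,2d}, Sigma_{n,2d}, C_{n,2d} and (Sigma+C)_{n,2d}. *)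

definition nonneg_circuits :: "nat \<Rightarrow> nat \<Rightarrow> real_mpoly set" where
  "nonneg_circuits n d =
     {f \<in> forms n (2 * d). is_circuit f \<and> (\<forall>x. eval_mpoly f x \<ge> 0)}"

definition sos_forms :: "nat \<Rightarrow> nat \<Rightarrow> real_mpoly set" where
  "sos_forms n d = {sum_list (map (\<lambda>g. g ^ 2) gs) | gs. set gs \<subseteq> forms n d}"

definition sonc_forms :: "nat \<Rightarrow> nat \<Rightarrow> real_mpoly set" where
  "sonc_forms n d = {sum_list hs | hs. set hs \<subseteq> nonneg_circuits n d}"

definition sos_plus_sonc :: "nat \<Rightarrow> nat \<Rightarrow> real_mpoly set" where
  "sos_plus_sonc n d = {g + h | g h. g \<in> sos_forms n d \<and> h \<in> sonc_forms n d}"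

end

theory Submission
  imports Defs
begin

text \<open>Let \<open>F = \<Sum>g\<^sup>2 + \<Sum>h\<close> with circuits \<open>h\<close>, let \<open>w\<close> be a linear functional, and consider the
  exponents in all the sets \<open>2 supp g\<close> and \<open>supp h\<close>. The least of them, for the order by \<open>w\<close> with
  ties broken lexicographically, has a positive coefficient in \<open>F\<close>: in \<open>g\<^sup>2\<close> it can only arise as a
  double, and in \<open>New h\<close> it is a vertex. So a lower bound for \<open>w\<close> on \<open>supp F\<close> passes to all the
  summands. With \<open>w \<alpha> = - \<alpha>\<^sub>i\<close> no summand contains a variable missing in \<open>F\<close>. With \<open>w \<alpha> = \<alpha>\<^sub>1\<close>, if
  \<open>x\<^sub>1\<close> to the power \<open>2l\<close> divides \<open>F\<close>, then it divides every \<open>h\<close> and every \<open>g\<^sup>2\<close>, and the quotients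
  are again squares and nonnegative circuits.\<close>

section \<open>Exponent vectors as points of a real vector space\<close>

lemma lookup_scaleR:
  fixes v :: "'a \<Rightarrow>\<^sub>0 real"
  shows "Poly_Mapping.lookup (c *\<^sub>R v) i = c * Poly_Mapping.lookup v i"
proof -
  have "finite {k. c *\<^sub>R Poly_Mapping.lookup v k \<noteq> 0}"
    by (rule finite_subset[OF _ finite_lookup[of v]]) auto
  then show ?thesis
    by (simp add: scaleR_poly_mapping_def)
qed

lemma linear_lookup: "linear (\<lambda>v :: 'a \<Rightarrow>\<^sub>0 real. Poly_Mapping.lookup v i)"
  by (rule linearI) (simp_all add: lookup_add lookup_scaleR)

lemma lookup_real_exp [simp]: "Poly_Mapping.lookup (real_exp \<alpha>) i = real (Poly_Mapping.lookup \<alpha> i)"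
  by (simp add: real_exp_def Poly_Mapping.map.rep_eq when_def)

lemma real_exp_add: "real_exp (\<alpha> + \<beta>) = real_exp \<alpha> + real_exp \<beta>"
  by (rule poly_mapping_eqI) (simp add: lookup_add)

lemma inj_real_exp: "inj real_exp"
  by (rule injI) (metis poly_mapping_eqI lookup_real_exp of_nat_eq_iff)

lemma keys_plus_nat:
  fixes \<alpha> \<beta> :: monom_exp
  shows "Poly_Mapping.keys (\<alpha> + \<beta>) = Poly_Mapping.keys \<alpha> \<union> Poly_Mapping.keys \<beta>"
  by (auto simp: in_keys_iff lookup_add)

lemma exp_degree_add: "exp_degree (\<alpha> + \<beta>) = exp_degree \<alpha> + exp_degree \<beta>"
proof -
  have superset: "exp_degree \<gamma> = (\<Sum>i\<in>Poly_Mapping.keys \<alpha> \<union> Poly_Mapping.keys \<beta>. Poly_Mapping.lookup \<gamma> i)"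
    if "Poly_Mapping.keys \<gamma> \<subseteq> Poly_Mapping.keys \<alpha> \<union> Poly_Mapping.keys \<beta>" for \<gamma>
    unfolding exp_degree_def using that
    by (intro sum.mono_neutral_left) (auto simp: in_keys_iff)
  show ?thesis
    by (simp add: superset keys_plus_nat lookup_add sum.distrib)
qed

section \<open>Positive leading coefficients\<close>

text \<open>The strict vector order "first compare the weights \<open>w\<close>, then compare lexicographically",
  given by its positive cone.\<close>

definition lex_pos :: "((nat \<Rightarrow>\<^sub>0 real) \<Rightarrow> real) \<Rightarrow> (nat \<Rightarrow>\<^sub>0 real) \<Rightarrow> bool" where
  "lex_pos w v \<longleftrightarrow> 0 < w v \<or> w v = 0 \<and> 0 < v"

text \<open>The order on finitely supported functions is lexicographic: the sign of the first
  nonzero entry decides, and positive scaling keeps it.\<close>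

lemma poly_mapping_scaleR_pos:
  fixes v :: "nat \<Rightarrow>\<^sub>0 real"
  assumes "0 < v" "0 < c"
  shows "0 < c *\<^sub>R v"
proof -
  obtain k where "0 < Poly_Mapping.lookup v k" "\<forall>k'<k. Poly_Mapping.lookup v k' = 0"
    using assms(1) by (auto simp: less_poly_mapping.rep_eq less_fun_def)
  then show ?thesis
    using assms(2) by (auto simp: less_poly_mapping.rep_eq less_fun_def lookup_scaleR intro!: exI[of _ k])
qed

lemma lex_pos_add:
  assumes "linear w" "lex_pos w u" "lex_pos w v"
  shows "lex_pos w (u + v)"
  using assms by (auto simp: lex_pos_def linear_add add_pos_pos)

lemma lex_pos_scaleR:
  assumes "linear w" "lex_pos w v" "0 < c"
  shows "lex_pos w (c *\<^sub>R v)"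
  using assms by (auto simp: lex_pos_def linear_scale poly_mapping_scaleR_pos)

lemma not_lex_pos_0:
  assumes "linear w"
  shows "\<not> lex_pos w 0"
  using assms by (simp add: lex_pos_def linear_0)

text \<open>The lexicographic tie-break makes vectors of equal weight comparable, so a minimal
  exponent is the unique least one.\<close>

lemma lex_pos_total:
  assumes "linear w"
  shows "v = 0 \<or> lex_pos w v \<or> lex_pos w (- v)"
  using assms neq_iff[of v 0] by (auto simp: lex_pos_def linear_neg)

text \<open>All of \<open>S\<close> lies in the translate of a pointed convex cone with apex
  \<open>m\<close>, hence so does the hull; the apex is not strictly between two distinct points of
  that translate.\<close>

lemma lex_min_extreme:
  assumes w: "linear w" and m: "m \<in> S"
    and min: "\<And>v. v \<in> S \<Longrightarrow> v = m \<or> lex_pos w (v - m)"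
  shows "m extreme_point_of (convex hull S)"
proof -
  have comb: "u *\<^sub>R x + v *\<^sub>R y - m = u *\<^sub>R (x - m) + v *\<^sub>R (y - m)"
    if "u + v = 1" for u v :: real and x y :: "nat \<Rightarrow>\<^sub>0 real"
  proof -
    have "m = (u + v) *\<^sub>R m"
      using that by simp
    then show ?thesis
      by (simp add: algebra_simps)
  qed
  have "convex {v. v = m \<or> lex_pos w (v - m)}"
  proof (rule convexI)
    fix x y and u v :: real
    assume xy: "x \<in> {v. v = m \<or> lex_pos w (v - m)}" "y \<in> {v. v = m \<or> lex_pos w (v - m)}"
      and uv: "0 \<le> u" "0 \<le> v" "u + v = 1"
    have nonneg: "a *\<^sub>R (z - m) = 0 \<or> lex_pos w (a *\<^sub>R (z - m))"
      if "0 \<le> a" "z = m \<or> lex_pos w (z - m)" for a z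
      using that lex_pos_scaleR[OF w, of "z - m" a] by (cases "a = 0") auto
    have "u *\<^sub>R (x - m) + v *\<^sub>R (y - m) = 0 \<or> lex_pos w (u *\<^sub>R (x - m) + v *\<^sub>R (y - m))"
      using nonneg[of u x] nonneg[of v y] xy uv lex_pos_add[OF w, of "u *\<^sub>R (x - m)" "v *\<^sub>R (y - m)"]
      by auto
    then show "u *\<^sub>R x + v *\<^sub>R y \<in> {v. v = m \<or> lex_pos w (v - m)}"
      unfolding comb[OF uv(3), symmetric] by simp
  qed
  then have hull: "convex hull S \<subseteq> {v. v = m \<or> lex_pos w (v - m)}"
    using min by (intro hull_minimal) auto
  have "m \<notin> open_segment a b" if ab: "a \<in> convex hull S" "b \<in> convex hull S" for a b
  proof
    assume "m \<in> open_segment a b"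
    then obtain u where u: "a \<noteq> b" "0 < u" "u < 1" "m = (1 - u) *\<^sub>R a + u *\<^sub>R b"
      by (auto simp: in_segment)
    have "0 = (1 - u) *\<^sub>R (a - m) + u *\<^sub>R (b - m)"
      using comb[of "1 - u" u a b] u(4) by simp
    \<comment> \<open>As \<open>a\<close> and \<open>b\<close> differ, at least one of the two terms
      is positive and the other is zero or positive, so their sum cannot be 0.\<close>
    moreover have "a = m \<or> lex_pos w ((1 - u) *\<^sub>R (a - m))" "b = m \<or> lex_pos w (u *\<^sub>R (b - m))"
      using ab hull u lex_pos_scaleR[OF w] by auto
    ultimately show False
      using u(1,2,3) lex_pos_add[OF w] not_lex_pos_0[OF w]
      by (metis add_0 add.right_neutral eq_iff_diff_eq_0 scaleR_zero_right)
  qed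
  then show ?thesis
    using m by (auto simp: extreme_point_of_def hull_inc)
qed

text \<open>The least exponent is a vertex of the Newton polytope, and the vertices of a circuit are
  exactly its even exponents with positive coefficient.\<close>

lemma circuit_min_coeff_pos:
  assumes w: "linear w" and h: "is_circuit h" and m: "m \<in> supp h"
    and min: "\<And>\<alpha>. \<alpha> \<in> supp h \<Longrightarrow> \<alpha> = m \<or> lex_pos w (real_exp \<alpha> - real_exp m)"
  shows "0 < Poly_Mapping.lookup h m"
proof -
  have "real_exp m extreme_point_of New h"
    unfolding New_def using m min by (intro lex_min_extreme[OF w]) auto
  then have "real_exp m \<in> real_exp ` even_pos_supp h"
    using h by (auto simp: is_circuit_def New_vertices_def)
  then have "m \<in> even_pos_supp h"
    using inj_real_exp by (simp add: inj_image_mem_iff)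
  then show ?thesis
    by (simp add: even_pos_supp_def)
qed

section \<open>Coefficients of products and squares\<close>

lemma lookup_mult_sum:
  fixes f g :: real_mpoly
  shows "Poly_Mapping.lookup (f * g) \<gamma> = (\<Sum>\<alpha>\<in>supp f. \<Sum>\<beta>\<in>supp g.
    if \<alpha> + \<beta> = \<gamma> then Poly_Mapping.lookup f \<alpha> * Poly_Mapping.lookup g \<beta> else 0)"
proof -
  have inner: "(\<Sum>q. Poly_Mapping.lookup g q when \<gamma> = \<alpha> + q) =
      (\<Sum>\<beta>\<in>supp g. if \<alpha> + \<beta> = \<gamma> then Poly_Mapping.lookup g \<beta> else 0)" for \<alpha>
    by (subst Sum_any.expand_superset[of "supp g"])
       (auto simp: in_keys_iff when_def intro!: sum.cong)
  have "Poly_Mapping.lookup (f * g) \<gamma> = (\<Sum>\<alpha>\<in>supp f. Poly_Mapping.lookup f \<alpha> *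
      (\<Sum>\<beta>\<in>supp g. if \<alpha> + \<beta> = \<gamma> then Poly_Mapping.lookup g \<beta> else 0))"
    unfolding lookup_mult inner
    by (subst Sum_any.expand_superset[of "supp f"]) (auto simp: in_keys_iff)
  then show ?thesis
    by (simp add: sum_distrib_left if_distrib cong: if_cong)
qed

text \<open>Here \<open>m\<close> is only a lower bound for the doubled exponents, because it will
  be the minimum over all summands at once. Strict positivity therefore needs \<open>m\<close> to be
  one of the doubles of \<open>g\<close>.\<close>

lemma square_min_coeff:
  fixes g :: real_mpoly
  assumes w: "linear w"
    and min: "\<And>\<alpha>. \<alpha> \<in> supp g \<Longrightarrow> \<alpha> + \<alpha> = m \<or> lex_pos w (real_exp (\<alpha> + \<alpha>) - real_exp m)"
  shows "0 \<le> Poly_Mapping.lookup (g ^ 2) m"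
    and "a \<in> supp g \<Longrightarrow> a + a = m \<Longrightarrow> 0 < Poly_Mapping.lookup (g ^ 2) m"
proof -
  define t where "t \<alpha> \<beta> = (if \<alpha> + \<beta> = m then Poly_Mapping.lookup g \<alpha> * Poly_Mapping.lookup g \<beta> else 0)"
    for \<alpha> \<beta>
  have eq: "Poly_Mapping.lookup (g ^ 2) m = (\<Sum>\<alpha>\<in>supp g. \<Sum>\<beta>\<in>supp g. t \<alpha> \<beta>)"
    by (simp add: power2_eq_square lookup_mult_sum t_def)
  \<comment> \<open>If they differed, both doubles would lie strictly above \<open>m\<close>,
    although \<open>m\<close> is their midpoint.\<close>
  have diag: "\<alpha> = \<beta>" if \<alpha>\<beta>: "\<alpha> \<in> supp g" "\<beta> \<in> supp g" "\<alpha> + \<beta> = m" for \<alpha> \<beta>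
  proof (rule ccontr)
    assume "\<alpha> \<noteq> \<beta>"
    then have "\<alpha> + \<alpha> \<noteq> m" "\<beta> + \<beta> \<noteq> m"
      using \<alpha>\<beta>(3) by auto
    then have "lex_pos w ((real_exp (\<alpha> + \<alpha>) - real_exp m) + (real_exp (\<beta> + \<beta>) - real_exp m))"
      using min \<alpha>\<beta>(1,2) lex_pos_add[OF w] by blast
    moreover have "(real_exp (\<alpha> + \<alpha>) - real_exp m) + (real_exp (\<beta> + \<beta>) - real_exp m) = 0"
      unfolding \<alpha>\<beta>(3)[symmetric] by (simp add: real_exp_add)
    ultimately show False
      using not_lex_pos_0[OF w] by simp
  qed
  have t_nonneg: "0 \<le> t \<alpha> \<beta>" if "\<alpha> \<in> supp g" "\<beta> \<in> supp g" for \<alpha> \<beta>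
    using diag[OF that] by (auto simp: t_def)
  then show "0 \<le> Poly_Mapping.lookup (g ^ 2) m"
    unfolding eq by (intro sum_nonneg)
  assume a: "a \<in> supp g" "a + a = m"
  then have "0 < t a a"
    by (auto simp: t_def in_keys_iff zero_less_mult_iff)
  then show "0 < Poly_Mapping.lookup (g ^ 2) m"
    unfolding eq using a t_nonneg
    by (intro sum_pos2[of _ a] sum_nonneg) (auto intro: sum_pos2[of _ a])
qed

lemma lookup_sum_list: "Poly_Mapping.lookup (sum_list ps) k = (\<Sum>p\<leftarrow>ps. Poly_Mapping.lookup p k)"
  by (induction ps) (simp_all add: lookup_add)

lemma sum_list_pos:
  fixes xs :: "real list"
  assumes "\<And>x. x \<in> set xs \<Longrightarrow> 0 \<le> x" and "x \<in> set xs" "0 < x"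
  shows "0 < sum_list xs"
  using assms
proof (induction xs)
  case (Cons y ys)
  have "0 \<le> sum_list ys"
    using Cons.prems(1) by (intro sum_list_nonneg) auto
  then show ?case
    using Cons by (auto simp: add_pos_nonneg add_nonneg_pos)
qed simp

text \<open>At the least exponent of all summands every contribution is nonnegative and one is
  positive, so this exponent survives in the sum and its weight is at least \<open>c\<close>; all
  other exponents weigh no less.\<close>

lemma summands_weight_ge:
  fixes w :: "(nat \<Rightarrow>\<^sub>0 real) \<Rightarrow> real"
  assumes w: "linear w" and hs: "\<And>h. h \<in> set hs \<Longrightarrow> is_circuit h"
    and c: "\<And>\<gamma>. \<gamma> \<in> supp (sum_list (map (\<lambda>g. g ^ 2) gs) + sum_list hs) \<Longrightarrow> c \<le> w (real_exp \<gamma>)"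
  shows "g \<in> set gs \<Longrightarrow> \<gamma> \<in> supp g \<Longrightarrow> c \<le> 2 * w (real_exp \<gamma>)"
    and "h \<in> set hs \<Longrightarrow> \<gamma> \<in> supp h \<Longrightarrow> c \<le> w (real_exp \<gamma>)"
proof -
  \<comment> \<open>For a square only the doubles are collected: the other exponents of
    \<open>g ^ 2\<close> are midpoints of two doubles.\<close>
  define T where "T = (\<lambda>\<alpha>. \<alpha> + \<alpha>) ` (\<Union>g\<in>set gs. supp g) \<union> (\<Union>h\<in>set hs. supp h)"
  define R where "R \<alpha> \<beta> \<longleftrightarrow> lex_pos w (real_exp \<beta> - real_exp \<alpha>)" for \<alpha> \<beta>
  have T_ge: "c \<le> w (real_exp \<tau>)" if \<tau>: "\<tau> \<in> T" for \<tau>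
  proof -
    have "finite T"
      by (simp add: T_def)
    moreover have "transp_on T R"
    proof (rule transp_onI)
      fix x y z
      assume "R x y" "R y z"
      then show "R x z"
        using lex_pos_add[OF w, of "real_exp y - real_exp x" "real_exp z - real_exp y"]
        by (simp add: R_def)
    qed
    moreover have "asymp_on T R"
    proof (rule asymp_onI)
      fix x y
      assume "R x y"
      then show "\<not> R y x"
        using lex_pos_add[OF w, of "real_exp y - real_exp x" "real_exp x - real_exp y"]
          not_lex_pos_0[OF w]
        by (auto simp: R_def)
    qed
    ultimately obtain m where m: "m \<in> T" "\<forall>x\<in>T. x \<noteq> m \<longrightarrow> \<not> R x m"
      using Finite_Set.bex_min_element[where A = T and R = R] \<tau> by blast
    have min: "\<alpha> = m \<or> lex_pos w (real_exp \<alpha> - real_exp m)" if "\<alpha> \<in> T" for \<alpha>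
      using m(2) that lex_pos_total[OF w, of "real_exp \<alpha> - real_exp m"] inj_real_exp
      by (auto simp: R_def inj_eq)
    have sq: "0 \<le> Poly_Mapping.lookup (g ^ 2) m"
      "a \<in> supp g \<Longrightarrow> a + a = m \<Longrightarrow> 0 < Poly_Mapping.lookup (g ^ 2) m" if "g \<in> set gs" for g a
      using that square_min_coeff[OF w, of g m] min by (auto simp: T_def)
    have ci: "0 < Poly_Mapping.lookup h m" if "h \<in> set hs" "m \<in> supp h" for h
      using circuit_min_coeff_pos[OF w hs[OF that(1)] that(2)] that min by (auto simp: T_def)
    have ci': "0 \<le> Poly_Mapping.lookup h m" if "h \<in> set hs" for h
      using ci[OF that] by (cases "m \<in> supp h") (auto simp: in_keys_iff)
    let ?xs = "map (\<lambda>p. Poly_Mapping.lookup p m) (map (\<lambda>g. g ^ 2) gs @ hs)"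
    \<comment> \<open>Membership of \<open>m\<close> in \<open>T\<close> names a summand that
      contributes strictly: some \<open>g\<close> with \<open>m\<close> among its doubles, or some
      \<open>h\<close> with \<open>m\<close> in its support.\<close>
    have "\<exists>x\<in>set ?xs. 0 < x"
      using m(1) sq(2) ci by (fastforce simp: T_def)
    moreover have "\<forall>x\<in>set ?xs. 0 \<le> x"
      using sq(1) ci' by auto
    ultimately have "0 < sum_list ?xs"
      using sum_list_pos[of ?xs] by blast
    then have "m \<in> supp (sum_list (map (\<lambda>g. g ^ 2) gs) + sum_list hs)"
      by (simp add: in_keys_iff lookup_add lookup_sum_list o_def)
    then have "c \<le> w (real_exp m)"
      by (rule c)
    \<comment> \<open>The weight is compared first, so the least exponent also has the least
      weight.\<close>
    also have "w (real_exp m) \<le> w (real_exp \<tau>)"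
      using min[OF \<tau>] linear_diff[OF w, of "real_exp \<tau>" "real_exp m"]
      by (auto simp: lex_pos_def)
    finally show ?thesis .
  qed
  show "c \<le> 2 * w (real_exp \<gamma>)" if "g \<in> set gs" "\<gamma> \<in> supp g"
  proof -
    have "\<gamma> + \<gamma> \<in> T"
      using that by (auto simp: T_def)
    from T_ge[OF this] show ?thesis
      by (simp only: real_exp_add linear_add[OF w] mult_2)
  qed
  show "c \<le> w (real_exp \<gamma>)" if "h \<in> set hs" "\<gamma> \<in> supp h"
    using T_ge[of \<gamma>] that by (auto simp: T_def)
qed

section \<open>Division by monomials\<close>

abbreviation monomial :: "monom_exp \<Rightarrow> real_mpoly" where
  "monomial u \<equiv> Poly_Mapping.single u 1"

lemma lookup_monomial_mult: "Poly_Mapping.lookup (monomial u * p) (u + \<alpha>) = Poly_Mapping.lookup p \<alpha>"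
proof -
  have "Poly_Mapping.lookup (monomial u * p) (u + \<alpha>) =
      (\<Sum>\<beta>\<in>supp p. if \<beta> = \<alpha> then Poly_Mapping.lookup p \<beta> else 0)"
    unfolding lookup_mult_sum by simp
  then show ?thesis
    by (simp add: in_keys_iff)
qed

lemma supp_monomial_mult: "supp (monomial u * p) = (+) u ` supp p"
proof
  show "supp (monomial u * p) \<subseteq> (+) u ` supp p"
    using keys_mult[of "monomial u" p] by auto
  show "(+) u ` supp p \<subseteq> supp (monomial u * p)"
    by (auto simp: in_keys_iff lookup_monomial_mult)
qed

lemma var_power: "var i ^ k = monomial (Poly_Mapping.single i k)"
  by (induction k) (simp_all add: var_def mult_single single_add[symmetric])

text \<open>The quotient has the coefficients of \<open>p\<close> read at shifted exponents;
  exponents outside the image of the shift carry coefficient 0 on both sides.\<close>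

lemma monomial_factor:
  assumes "\<And>\<alpha>. \<alpha> \<in> supp p \<Longrightarrow> k \<le> Poly_Mapping.lookup \<alpha> i"
  obtains q where "p = monomial (Poly_Mapping.single i k) * q"
proof
  let ?u = "Poly_Mapping.single i k"
  have inj: "inj ((+) ?u)"
    by simp
  let ?q = "Poly_Mapping.map_key ((+) ?u) p"
  show "p = monomial ?u * ?q"
  proof (rule poly_mapping_eqI)
    fix \<alpha>
    show "Poly_Mapping.lookup p \<alpha> = Poly_Mapping.lookup (monomial ?u * ?q) \<alpha>"
    proof (cases "k \<le> Poly_Mapping.lookup \<alpha> i")
      case True
      \<comment> \<open>Truncated subtraction is exact here: \<open>?u\<close> is 0 away from
        \<open>i\<close>, and at \<open>i\<close> the case assumption applies.\<close>
      then have "\<alpha> = ?u + (\<alpha> - ?u)"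
        by (intro poly_mapping_eqI) (auto simp: lookup_add lookup_minus lookup_single when_def)
      then obtain \<beta> where "\<alpha> = ?u + \<beta>" ..
      then show ?thesis
        by (simp add: lookup_monomial_mult Poly_Mapping.map_key.rep_eq[OF inj])
    next
      case False
      then have "\<alpha> \<notin> supp (monomial ?u * ?q)"
        by (auto simp: supp_monomial_mult lookup_add)
      then show ?thesis
        using False assms by (auto simp: in_keys_iff)
    qed
  qed
qed

section \<open>Forms and circuits under translation of exponents\<close>

lemma forms_monomial_mult_iff:
  assumes "Poly_Mapping.keys u \<subseteq> {..<n}"
  shows "monomial u * p \<in> forms n (exp_degree u + k) \<longleftrightarrow> p \<in> forms n k"
  using assms by (auto simp: forms_def supp_monomial_mult keys_plus_nat exp_degree_add)

text \<open>The translate of the open set witnessing membership is again a witness. The setting is a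
  general normed space because the space of finitely supported functions on \<open>nat\<close> is
  infinite-dimensional.\<close>

lemma rel_interior_translationI:
  fixes a :: "'a :: real_normed_vector"
  assumes "x \<in> rel_interior S"
  shows "a + x \<in> rel_interior ((+) a ` S)"
proof -
  obtain T where T: "open T" "x \<in> T \<inter> S" "T \<inter> affine hull S \<subseteq> S"
    using assms by (auto simp: mem_rel_interior)
  have "open ((+) a ` T)"
    using open_translation[OF T(1), of a] by simp
  moreover have "(+) a ` T \<inter> affine hull ((+) a ` S) \<subseteq> (+) a ` S"
    using T(3) affine_hull_translation[of a S] by auto
  ultimately show ?thesis
    using T(2) unfolding mem_rel_interior by (intro exI[of _ "(+) a ` T"]) auto
qed

lemma rel_interior_translation_iff:
  fixes a :: "'a :: real_normed_vector"
  shows "a + x \<in> rel_interior ((+) a ` S) \<longleftrightarrow> x \<in> rel_interior S"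
  using rel_interior_translationI[of x S a] rel_interior_translationI[of "a + x" "(+) a ` S" "- a"]
  by (auto simp: image_image)

text \<open>An even shift preserves parities and coefficients, hence the splitting of the support;
  the remaining conditions are affine geometry and invariant under translation.\<close>

lemma is_circuit_monomial_mult_iff:
  assumes even_u: "\<And>i. even (Poly_Mapping.lookup u i)"
  shows "is_circuit (monomial u * p) \<longleftrightarrow> is_circuit p"
proof -
  let ?t = "(+) (real_exp u)"
  have im: "real_exp ` (+) u ` A = ?t ` real_exp ` A" for A
    by (auto simp: image_image real_exp_add)
  have E: "even_pos_supp (monomial u * p) = (+) u ` even_pos_supp p"
    using even_u by (auto simp: even_pos_supp_def supp_monomial_mult lookup_monomial_mult lookup_add)
  have R: "rest_supp (monomial u * p) = (+) u ` rest_supp p"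
    unfolding rest_supp_def E supp_monomial_mult by (simp add: image_set_diff)
  have N: "New (monomial u * p) = ?t ` New p"
    unfolding New_def supp_monomial_mult im by (rule convex_hull_translation)
  have V: "New_vertices (monomial u * p) = ?t ` New_vertices p"
    unfolding New_vertices_def N by (rule extreme_points_of_translation)
  have inj: "inj ?t"
    by simp
  have "(\<exists>\<beta>. rest_supp (monomial u * p) = {\<beta>} \<and> real_exp \<beta> \<in> rel_interior (New (monomial u * p)))
    \<longleftrightarrow> (\<exists>\<beta>. rest_supp p = {\<beta>} \<and> real_exp \<beta> \<in> rel_interior (New p))" (is "?l \<longleftrightarrow> ?r")
  proof
    assume ?l
    then obtain \<beta> where \<beta>: "(+) u ` rest_supp p = {\<beta>}" "real_exp \<beta> \<in> rel_interior (?t ` New p)"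
      by (auto simp: R N)
    then obtain \<gamma> where \<gamma>: "\<gamma> \<in> rest_supp p" "\<beta> = u + \<gamma>"
      by blast
    moreover have "\<delta> = \<gamma>" if "\<delta> \<in> rest_supp p" for \<delta>
      using imageI[OF that, of "(+) u"] \<beta>(1) \<gamma>(2) by simp
    ultimately have "rest_supp p = {\<gamma>}"
      by blast
    with \<beta> \<gamma> show ?r
      by (auto simp: real_exp_add rel_interior_translation_iff)
  next
    assume ?r
    then obtain \<gamma> where "rest_supp p = {\<gamma>}" "real_exp \<gamma> \<in> rel_interior (New p)"
      by blast
    then show ?l
      by (intro exI[of _ "u + \<gamma>"]) (simp add: R N real_exp_add rel_interior_translation_iff)
  qed
  then show ?thesis
    unfolding is_circuit_def
    by (simp add: E V im R inj_image_eq_iff[OF inj] affine_dependent_translation_eq[of _ "real_exp u", symmetric])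
qed

section \<open>Evaluation and nonnegativity of quotients\<close>

definition eval_monom :: "monom_exp \<Rightarrow> (nat \<Rightarrow> real) \<Rightarrow> real" where
  "eval_monom \<alpha> x = (\<Prod>i\<in>Poly_Mapping.keys \<alpha>. x i ^ Poly_Mapping.lookup \<alpha> i)"

lemma eval_monom_add: "eval_monom (\<alpha> + \<beta>) x = eval_monom \<alpha> x * eval_monom \<beta> x"
proof -
  have superset: "eval_monom \<gamma> x = (\<Prod>i\<in>Poly_Mapping.keys \<alpha> \<union> Poly_Mapping.keys \<beta>. x i ^ Poly_Mapping.lookup \<gamma> i)"
    if "Poly_Mapping.keys \<gamma> \<subseteq> Poly_Mapping.keys \<alpha> \<union> Poly_Mapping.keys \<beta>" for \<gamma>
    unfolding eval_monom_def using that
    by (intro prod.mono_neutral_left) (auto simp: in_keys_iff)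
  show ?thesis
    by (simp add: superset keys_plus_nat lookup_add power_add prod.distrib)
qed

lemma eval_monomial_mult: "eval_mpoly (monomial u * p) x = eval_monom u x * eval_mpoly p x"
  unfolding eval_mpoly_def eval_monom_def[symmetric] supp_monomial_mult
  by (simp add: sum.reindex lookup_monomial_mult eval_monom_add sum_distrib_left mult.left_commute)

text \<open>Off the hyperplane where coordinate \<open>i\<close> vanishes, the even power is
  positive and can be divided out; continuity in that coordinate covers the hyperplane.\<close>

lemma nonneg_of_var_power_mult_nonneg:
  assumes "\<And>x. 0 \<le> eval_mpoly (monomial (Poly_Mapping.single i (2 * l)) * p) x"
  shows "0 \<le> eval_mpoly p x"
proof -
  let ?e = "\<lambda>t. eval_mpoly p (x(i := t))"
  have off: "0 \<le> ?e t" if "t \<noteq> 0" for t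
  proof -
    have "eval_monom (Poly_Mapping.single i (2 * l)) (x(i := t)) = t ^ (2 * l)"
      \<comment> \<open>For \<open>l = 0\<close> the exponent vector has no keys and the product is
        empty.\<close>
      by (cases "l = 0") (simp_all add: eval_monom_def)
    moreover have "0 < t ^ (2 * l)"
      using that by (simp add: zero_less_power_eq)
    ultimately show ?thesis
      using assms[of "x(i := t)"] by (simp add: eval_monomial_mult zero_le_mult_iff)
  qed
  have "isCont ?e 0"
    unfolding eval_mpoly_def
  proof (intro continuous_intros)
    show "isCont (\<lambda>t. (x(i := t)) j) 0" for j
      by (cases "j = i") auto
  qed
  then have "(?e \<longlongrightarrow> ?e 0) (at 0)"
    by (simp add: isCont_def)
  then have "0 \<le> ?e 0"
    by (rule tendsto_lowerbound) (auto simp: eventually_at_filter off)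
  then show ?thesis
    using off[of "x i"] by (cases "x i = 0") (auto simp: fun_upd_idem)
qed

section \<open>Reducing the number of variables and the degree\<close>

lemma forms_fewer_variables:
  assumes "p \<in> forms k e" and "\<And>\<alpha> i. \<alpha> \<in> supp p \<Longrightarrow> n \<le> i \<Longrightarrow> Poly_Mapping.lookup \<alpha> i = 0"
  shows "p \<in> forms n e"
proof -
  have "Poly_Mapping.keys \<alpha> \<subseteq> {..<n}" if "\<alpha> \<in> supp p" for \<alpha>
    using assms(2)[OF that] by (meson in_keys_iff lessThan_iff not_le subsetI)
  then show ?thesis
    using assms(1) by (simp add: forms_def)
qed

lemma sos_plus_soncI:
  assumes "set gs \<subseteq> forms n d" "set hs \<subseteq> nonneg_circuits n d"
  shows "sum_list (map (\<lambda>g. g ^ 2) gs) + sum_list hs \<in> sos_plus_sonc n d"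
  unfolding sos_plus_sonc_def sos_forms_def sonc_forms_def using assms by blast

text \<open>The given decomposition itself serves in \<open>n\<close> variables: its summands
  contain no variable of index \<open>n\<close> or higher.\<close>

lemma sos_plus_sonc_fewer_variables:
  assumes f: "f \<in> forms n (2 * d)" and sum: "f \<in> sos_plus_sonc k d"
  shows "f \<in> sos_plus_sonc n d"
proof -
  obtain gs hs where gs: "set gs \<subseteq> forms k d" and hs: "set hs \<subseteq> nonneg_circuits k d"
    and f_eq: "f = sum_list (map (\<lambda>g. g ^ 2) gs) + sum_list hs"
    using sum by (auto simp: sos_plus_sonc_def sos_forms_def sonc_forms_def)
  have circ: "is_circuit h" if "h \<in> set hs" for h
    using that hs by (auto simp: nonneg_circuits_def)
  \<comment> \<open>With the negated coordinate as weight, the lower bound 0 says that the exponent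
    of variable \<open>i\<close> is at most 0, hence equal to 0.\<close>
  have bound: "0 \<le> - Poly_Mapping.lookup (real_exp \<gamma>) i"
    if "\<gamma> \<in> supp (sum_list (map (\<lambda>g. g ^ 2) gs) + sum_list hs)" "n \<le> i" for \<gamma> i
    using that f by (force simp: f_eq[symmetric] forms_def in_keys_iff)
  have lin: "linear (\<lambda>v :: nat \<Rightarrow>\<^sub>0 real. - Poly_Mapping.lookup v i)" for i
    by (intro linear_compose_neg linear_lookup)
  have "g \<in> forms n d" if g: "g \<in> set gs" for g
  proof (rule forms_fewer_variables)
    show "g \<in> forms k d"
      using g gs by blast
    show "Poly_Mapping.lookup \<alpha> i = 0" if "\<alpha> \<in> supp g" "n \<le> i" for \<alpha> i
      using summands_weight_ge(1)[OF lin circ bound[OF _ that(2)] g that(1)] by simp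
  qed
  moreover have "h \<in> nonneg_circuits n d" if h: "h \<in> set hs" for h
  proof -
    have "h \<in> forms n (2 * d)"
    proof (rule forms_fewer_variables)
      show "h \<in> forms k (2 * d)"
        using h hs by (auto simp: nonneg_circuits_def)
      show "Poly_Mapping.lookup \<alpha> i = 0" if "\<alpha> \<in> supp h" "n \<le> i" for \<alpha> i
        using summands_weight_ge(2)[where gs = gs, OF lin circ bound[OF _ that(2)] h that(1)] by simp
    qed
    then show ?thesis
      using h hs by (auto simp: nonneg_circuits_def)
  qed
  ultimately show ?thesis
    unfolding f_eq by (intro sos_plus_soncI subsetI)
qed

text \<open>Dividing each \<open>g\<close> by the power \<open>l\<close> and each \<open>h\<close>
  by the power \<open>2 * l\<close> of the variable turns the decomposition of the product into one
  of \<open>f\<close>.\<close>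

lemma sos_plus_sonc_cancel_var_power:
  assumes i: "i < n" and sum: "var i ^ (2 * l) * f \<in> sos_plus_sonc n (d + l)"
  shows "f \<in> sos_plus_sonc n d"
proof -
  define u where "u k = Poly_Mapping.single i k" for k :: nat
  have u: "Poly_Mapping.keys (u k) \<subseteq> {..<n}" "exp_degree (u k) = k" for k
    using i by (auto simp: u_def exp_degree_def)
  have u_double: "monomial (u l) ^ 2 = monomial (u (2 * l))"
    by (simp add: u_def power2_eq_square mult_single single_add[symmetric] mult_2)
  obtain gs hs where gs: "set gs \<subseteq> forms n (d + l)" and hs: "set hs \<subseteq> nonneg_circuits n (d + l)"
    and f_eq: "monomial (u (2 * l)) * f = sum_list (map (\<lambda>g. g ^ 2) gs) + sum_list hs"
    using sum by (auto simp: sos_plus_sonc_def sos_forms_def sonc_forms_def var_power u_def)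
  have circ: "is_circuit h" if "h \<in> set hs" for h
    using that hs by (auto simp: nonneg_circuits_def)
  have bound: "real (2 * l) \<le> Poly_Mapping.lookup (real_exp \<gamma>) i"
    if "\<gamma> \<in> supp (sum_list (map (\<lambda>g. g ^ 2) gs) + sum_list hs)" for \<gamma>
    using that by (auto simp: f_eq[symmetric] supp_monomial_mult lookup_add u_def)
  have "\<exists>q\<in>forms n d. g = monomial (u l) * q" if g: "g \<in> set gs" for g
  proof -
    \<comment> \<open>The bound \<open>2 * l\<close> holds for the doubled exponent, which leaves
      \<open>l\<close> for the exponent itself.\<close>
    have "l \<le> Poly_Mapping.lookup \<alpha> i" if "\<alpha> \<in> supp g" for \<alpha>
      using summands_weight_ge(1)[OF linear_lookup circ bound g that] by simp
    then obtain q where q: "g = monomial (u l) * q"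
      unfolding u_def by (rule monomial_factor)
    then show ?thesis
      using g gs forms_monomial_mult_iff[OF u(1), of l q d] by (auto simp: u(2) add.commute)
  qed
  then have "\<forall>g\<in>set gs. \<exists>q. q \<in> forms n d \<and> g = monomial (u l) * q"
    by blast
  from bchoice[OF this] obtain qg
    where qg: "\<forall>g\<in>set gs. qg g \<in> forms n d \<and> g = monomial (u l) * qg g" ..
  have "\<exists>q\<in>nonneg_circuits n d. h = monomial (u (2 * l)) * q" if h: "h \<in> set hs" for h
  proof -
    have "2 * l \<le> Poly_Mapping.lookup \<alpha> i" if "\<alpha> \<in> supp h" for \<alpha>
      using summands_weight_ge(2)[where gs = gs, OF linear_lookup circ bound h that] by simp
    then obtain q where q: "h = monomial (u (2 * l)) * q"
      unfolding u_def by (rule monomial_factor)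
    have "q \<in> forms n (2 * d)"
      using h hs q forms_monomial_mult_iff[OF u(1), of "2 * l" q "2 * d"]
      by (auto simp: u(2) nonneg_circuits_def algebra_simps)
    moreover have "is_circuit q"
      using circ[OF h] unfolding q
      by (subst (asm) is_circuit_monomial_mult_iff) (auto simp: u_def lookup_single when_def)
    moreover have "0 \<le> eval_mpoly h x" for x
      using h hs by (auto simp: nonneg_circuits_def)
    then have "0 \<le> eval_mpoly q x" for x
      unfolding q u_def by (rule nonneg_of_var_power_mult_nonneg)
    ultimately have "q \<in> nonneg_circuits n d"
      by (simp add: nonneg_circuits_def)
    with q show ?thesis ..
  qed
  then have "\<forall>h\<in>set hs. \<exists>q. q \<in> nonneg_circuits n d \<and> h = monomial (u (2 * l)) * q"
    by blast
  from bchoice[OF this] obtain qh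
    where qh: "\<forall>h\<in>set hs. qh h \<in> nonneg_circuits n d \<and> h = monomial (u (2 * l)) * qh h" ..
  have "g ^ 2 = monomial (u (2 * l)) * qg g ^ 2" if "g \<in> set gs" for g
  proof -
    have "g ^ 2 = (monomial (u l) * qg g) ^ 2"
      using bspec[OF qg that] by (intro arg_cong[where f = "\<lambda>p. p ^ 2"]) (rule conjunct2)
    then show ?thesis
      by (simp only: power_mult_distrib u_double)
  qed
  then have "(\<Sum>g\<leftarrow>gs. g ^ 2) = (\<Sum>g\<leftarrow>gs. monomial (u (2 * l)) * qg g ^ 2)"
    by (intro arg_cong[where f = sum_list] map_cong) auto
  moreover have "map (\<lambda>h. monomial (u (2 * l)) * qh h) hs = hs"
    by (rule map_idI) (rule sym[OF conjunct2[OF bspec[OF qh]]])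
  then have "sum_list hs = (\<Sum>h\<leftarrow>hs. monomial (u (2 * l)) * qh h)"
    by simp
  ultimately have "monomial (u (2 * l)) * f =
      monomial (u (2 * l)) * (sum_list (map (\<lambda>g. g ^ 2) (map qg gs)) + sum_list (map qh hs))"
    unfolding f_eq by (simp add: sum_list_const_mult distrib_left o_def)
  \<comment> \<open>Polynomials have no zero divisors, so the common nonzero factor can be
    cancelled.\<close>
  moreover have "monomial (u (2 * l)) \<noteq> 0"
    by (metis lookup_single_eq lookup_zero zero_neq_one)
  ultimately have "f = sum_list (map (\<lambda>g. g ^ 2) (map qg gs)) + sum_list (map qh hs)"
    using mult_left_cancel by blast
  moreover have "set (map qg gs) \<subseteq> forms n d" "set (map qh hs) \<subseteq> nonneg_circuits n d"
    using qg qh by auto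
  ultimately show ?thesis
    using sos_plus_soncI by metis
qed

theorem proposition4p5:
  fixes n d :: nat and f :: real_mpoly
  assumes "n \<ge> 1" and "d \<ge> 1"
    and "f \<in> forms n (2 * d)"
    and "f \<notin> sos_plus_sonc n d"
  shows "\<forall>m\<ge>1. \<forall>l\<ge>1.
           f \<notin> sos_plus_sonc (n + m) d \<and>
           var 0 ^ (2 * l) * f \<notin> sos_plus_sonc n (d + l)"
  \<comment> \<open>Both claims are contrapositives; \<open>n \<ge> 1\<close> puts index 0, the
    usual first variable, among the \<open>n\<close> variables.\<close>
  using assms sos_plus_sonc_fewer_variables[of f n d] sos_plus_sonc_cancel_var_power[of 0 n _ f d]
  by auto

end
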